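(* For every $n\geq 1$, the sequence $I_{n,0},I_{n,1},\ldots,I_{n,n-1}$ is unimodal, i.e., there is an index $j$ with $I_{n,0}\leq\cdots\leq I_{n,j}\geq I_{n,j+1}\geq\cdots\geq I_{n,n-1}$.
   Context: For a permutation $\pi=a_1a_2\cdots a_m$ of $[m]=\{1,\ldots,m\}$, a descent is an index $1\leq i\leq m-1$ with $a_i>a_{i+1}$. An involution of $[m]$ is a permutation $\pi$ with $\pi^2=\mathrm{id}$. $I_{m,j}$ denotes the number of involutions of $[m]$ with exactly $j$ descents. *)

theory Defs
  imports "HOL-Combinatorics.Permutations"
begin

definition involutions :: "nat \<Rightarrow> (nat \<Rightarrow> nat) set" where
  "involutions m = {p. p permutes {1..m} \<and> p \<circ> p = id}"

definition descents :: "nat \<Rightarrow> (nat \<Rightarrow> nat) \<Rightarrow> nat set" where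
  "descents m p = {i. 1 \<le> i \<and> i \<le> m - 1 \<and> p i > p (Suc i)}"

definition des :: "nat \<Rightarrow> (nat \<Rightarrow> nat) \<Rightarrow> nat" where
  "des m p = card (descents m p)"

definition I :: "nat \<Rightarrow> nat \<Rightarrow> nat" where
  "I m j = card {p \<in> involutions m. des m p = j}"

end

theory Submission
  imports Defs "HOL-Library.Product_Lexorder" "HOL-Library.Infinite_Set"
begin

text \<open>
  Recording, for an involution \<open>\<sigma>\<close> and a weakly increasing word \<open>f\<close> that strictly increases at the
  descents of \<open>\<sigma>\<close>, how often the pair of values \<open>(f a, f (\<sigma> a))\<close> occurs gives a bijection onto
  the symmetric matrices of natural numbers with entry sum \<open>n\<close>. Counting such matrices with one
  marked unit yields a recurrence in \<open>n\<close> for their number, and Worpitzky's identity turns it into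
  the recurrence of Guo and Zeng for \<open>I n k\<close>. This recurrence is invariant under
  \<open>k \<mapsto> n - 1 - k\<close>, and the induced recurrence for the first differences has nonnegative
  coefficients up to the middle; the boundary terms there are controlled by the symmetry.
\<close>

subsection \<open>Symmetric matrices with given entry sum\<close>

text \<open>Vanishing outside the square makes each matrix a single function, so matrices can be
  compared and counted as functions.\<close>

definition sym_matrices :: "nat \<Rightarrow> nat \<Rightarrow> (nat \<times> nat \<Rightarrow> nat) set" where
  "sym_matrices q n = {M. (\<forall>p. M (prod.swap p) = M p) \<and>
     (\<forall>p. p \<notin> {..<q} \<times> {..<q} \<longrightarrow> M p = 0) \<and> sum M ({..<q} \<times> {..<q}) = n}"

lemma finite_sym_matrices: "finite (sym_matrices q n)"
proof (rule finite_subset)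
  let ?R = "{..<q} \<times> {..<q}"
  show "sym_matrices q n \<subseteq> {M. \<forall>p. (p \<in> ?R \<longrightarrow> M p \<in> {..n}) \<and> (p \<notin> ?R \<longrightarrow> M p = 0)}"
  proof (intro subsetI CollectI allI conjI impI)
    fix M p assume M: "M \<in> sym_matrices q n"
    show "p \<notin> ?R \<Longrightarrow> M p = 0"
      using M by (simp add: sym_matrices_def del: mem_Sigma_iff split_paired_All)
    assume "p \<in> ?R"
    then have "M p \<le> sum M ?R" by (intro member_le_sum) auto
    then show "M p \<in> {..n}" using M by (simp add: sym_matrices_def)
  qed
  show "finite {M. \<forall>p. (p \<in> ?R \<longrightarrow> M p \<in> {..n}) \<and> (p \<notin> ?R \<longrightarrow> M p = (0::nat))}"
    by (rule finite_set_of_finite_funs) auto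
qed

text \<open>A unit added at \<open>p\<close> must be added at the transposed position too. The
  cardinality of \<open>{p, prod.swap p}\<close> is 1 on the diagonal and 2 off it, so one statement
  serves both cases.\<close>

lemma bij_betw_add_unit:
  assumes p: "p \<in> {..<q} \<times> {..<q}"
  defines "u \<equiv> \<lambda>z. if z \<in> {p, prod.swap p} then 1 else 0 :: nat"
  shows "bij_betw (\<lambda>M z. M z + u z) (sym_matrices q n)
     {M \<in> sym_matrices q (n + card {p, prod.swap p}). M p > 0}"
proof (rule bij_betw_byWitness[where f' = "\<lambda>M z. M z - u z"])
  let ?R = "{..<q} \<times> {..<q}"
  have sub: "{p, prod.swap p} \<subseteq> ?R" using p by auto
  have "sum u ?R = sum u {p, prod.swap p}"
    using sub by (intro sum.mono_neutral_right) (auto simp: u_def)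
  also have "\<dots> = card {p, prod.swap p}" by (simp add: u_def)
  finally have sum_u: "sum u ?R = card {p, prod.swap p}" .
  have u_swap: "u (prod.swap z) = u z" for z unfolding u_def by (cases p; cases z) auto
  have u_out: "u z = 0" if "z \<notin> ?R" for z using sub that unfolding u_def by auto
  show "(\<lambda>M z. M z + u z) ` sym_matrices q n
      \<subseteq> {M \<in> sym_matrices q (n + card {p, prod.swap p}). M p > 0}"
  proof (intro image_subsetI CollectI conjI)
    fix M assume M: "M \<in> sym_matrices q n"
    then show "(\<lambda>z. M z + u z) \<in> sym_matrices q (n + card {p, prod.swap p})"
      by (simp add: sym_matrices_def sum.distrib sum_u u_swap u_out del: mem_Sigma_iff split_paired_All)
    show "M p + u p > 0" by (simp add: u_def)
  qed
  \<comment> \<open>By symmetry, positivity at \<open>p\<close> gives positivity at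
    \<open>prod.swap p\<close>, so the truncated subtraction of \<open>u\<close> is exact.\<close>
  have le: "u z \<le> M z" if "M \<in> sym_matrices q m" "M p > 0" for M z m
    using that unfolding sym_matrices_def u_def by (auto simp: Suc_le_eq simp del: split_paired_All)
  then show "\<forall>M\<in>{M \<in> sym_matrices q (n + card {p, prod.swap p}). M p > 0}.
      (\<lambda>z. M z - u z + u z) = M" by (auto simp: fun_eq_iff)
  show "(\<lambda>M z. M z - u z) ` {M \<in> sym_matrices q (n + card {p, prod.swap p}). M p > 0}
      \<subseteq> sym_matrices q n"
  proof (intro image_subsetI)
    fix M assume "M \<in> {M \<in> sym_matrices q (n + card {p, prod.swap p}). M p > 0}"
    then have M: "M \<in> sym_matrices q (n + card {p, prod.swap p})" "M p > 0" by auto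
    have "(\<Sum>z\<in>?R. M z - u z) = sum M ?R - sum u ?R"
      by (rule sum_subtractf_nat) (rule le[OF M])
    then show "(\<lambda>z. M z - u z) \<in> sym_matrices q n"
      using M(1) by (simp add: sym_matrices_def u_swap sum_u del: mem_Sigma_iff split_paired_All)
  qed
qed simp

text \<open>The left side counts matrices with a marked unit at \<open>p\<close>. Matrices with
  \<open>M p = 0\<close> contribute nothing, and every other one arises by adding a unit to a unique
  smaller matrix.\<close>

lemma sum_entry_sym_matrices:
  assumes p: "p \<in> {..<q} \<times> {..<q}"
  shows "(\<Sum>M\<in>sym_matrices q (n + card {p, prod.swap p}). M p)
       = (\<Sum>M\<in>sym_matrices q n. M p) + card (sym_matrices q n)"
proof -
  have "(\<Sum>M\<in>sym_matrices q (n + card {p, prod.swap p}). M p)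
      = (\<Sum>M\<in>{M \<in> sym_matrices q (n + card {p, prod.swap p}). M p > 0}. M p)"
    by (rule sum.mono_neutral_right) (auto simp: finite_sym_matrices)
  also have "\<dots> = (\<Sum>M\<in>sym_matrices q n. M p + 1)"
    by (subst sum.reindex_bij_betw[OF bij_betw_add_unit[OF p], symmetric]) (simp add: if_distrib)
  also have "\<dots> = (\<Sum>M\<in>sym_matrices q n. M p) + card (sym_matrices q n)"
    unfolding sum.distrib by simp
  finally show ?thesis .
qed

text \<open>Double count the matrices with one marked unit. Each of the \<open>q^2\<close> positions
  passes from \<open>n\<close> to \<open>n + 2\<close> by \<open>sum_entry_sym_matrices\<close>; the
  \<open>q\<close> diagonal ones need two steps, which produces the extra term with
  \<open>n + 1\<close>.\<close>

lemma card_sym_matrices_rec: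
  "(n + 2) * card (sym_matrices q (n + 2))
     = q * card (sym_matrices q (n + 1)) + (q^2 + n) * card (sym_matrices q n)"
proof -
  let ?R = "{..<q} \<times> {..<q}"
  define S where "S n = card (sym_matrices q n)" for n
  define T where "T p n = (\<Sum>M\<in>sym_matrices q n. M p)" for p n
  have sum_T: "(\<Sum>p\<in>?R. T p m) = m * S m" for m
  proof -
    have "(\<Sum>p\<in>?R. T p m) = (\<Sum>M\<in>sym_matrices q m. sum M ?R)"
      unfolding T_def by (rule sum.swap)
    also have "\<dots> = (\<Sum>M\<in>sym_matrices q m. m)"
      by (rule sum.cong) (auto simp: sym_matrices_def)
    finally show ?thesis by (simp add: S_def)
  qed
  have T: "T p (n + 2) = T p n + S n + (if snd p = fst p then S (n + 1) else 0)" if p: "p \<in> ?R" for p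
  proof (cases "snd p = fst p")
    case True
    then have "card {p, prod.swap p} = 1" by (cases p) auto
    then have "T p (Suc m) = T p m + S m" for m
      using sum_entry_sym_matrices[OF p, of m] by (simp add: T_def S_def)
    then show ?thesis using True by simp
  next
    case False
    then have "card {p, prod.swap p} = 2" by (cases p) auto
    then show ?thesis
      using sum_entry_sym_matrices[OF p, of n] False by (simp add: T_def S_def)
  qed
  have "(n + 2) * S (n + 2) = (\<Sum>p\<in>?R. T p n + S n + (if snd p = fst p then S (n + 1) else 0))"
    unfolding sum_T[symmetric] by (rule sum.cong) (simp_all only: T)
  also have "\<dots> = n * S n + q^2 * S n + (\<Sum>x<q. \<Sum>y<q. if y = x then S (n + 1) else 0)"
    unfolding sum.distrib sum_T sum.cartesian_product case_prod_beta
    by (simp add: power2_eq_square)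
  also have "(\<Sum>x<q. \<Sum>y<q. if y = x then S (n + 1) else 0) = q * S (n + 1)"
    by simp
  finally show ?thesis by (simp add: S_def algebra_simps)
qed

subsection \<open>Weakly increasing words with prescribed strict ascents\<close>

text \<open>These are the words enumerated by Gessel's fundamental quasisymmetric function of
  \<open>D\<close> in \<open>q\<close> variables.\<close>

definition weak_seqs :: "nat set \<Rightarrow> nat \<Rightarrow> nat \<Rightarrow> (nat \<Rightarrow> nat) set" where
  "weak_seqs D n q = {f \<in> {1..n} \<rightarrow>\<^sub>E {..<q}.
     \<forall>i. 1 \<le> i \<and> i < n \<longrightarrow> f i \<le> f (Suc i) \<and> (i \<in> D \<longrightarrow> f i < f (Suc i))}"

lemma finite_weak_seqs: "finite (weak_seqs D n q)"
  unfolding weak_seqs_def by (rule finite_Collect_conjI) (simp add: finite_PiE)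

lemma weak_seqs_mono:
  assumes "f \<in> weak_seqs D n q" "1 \<le> i" "i \<le> j" "j \<le> n"
  shows "f i \<le> f j"
  using assms(3,4)
proof (induction j rule: dec_induct)
  case (step m)
  then have "f m \<le> f (Suc m)" using assms(1,2) unfolding weak_seqs_def by simp
  with step show ?case by simp
qed simp

text \<open>Delete the last letter, the largest one available. The remaining word may use it as
  well, unless \<open>n \<in> D\<close> forces a strict rise to it.\<close>

lemma card_weak_seqs_last:
  assumes "n \<ge> 1"
  shows "card {f \<in> weak_seqs D (Suc n) (Suc q). f (Suc n) = q}
       = card (weak_seqs D n (if n \<in> D then q else Suc q))"
proof (rule bij_betw_same_card)
  let ?A = "{f \<in> weak_seqs D (Suc n) (Suc q). f (Suc n) = q}"
  let ?B = "weak_seqs D n (if n \<in> D then q else Suc q)"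
  show "bij_betw (\<lambda>f. f(Suc n := undefined)) ?A ?B"
  proof (rule bij_betw_byWitness[where f' = "\<lambda>f. f(Suc n := q)"])
    show "(\<lambda>f. f(Suc n := undefined)) ` ?A \<subseteq> ?B"
    proof (intro image_subsetI)
      fix f assume "f \<in> ?A"
      then have f: "f \<in> weak_seqs D (Suc n) (Suc q)" and q: "f (Suc n) = q" by auto
      have step: "f i \<le> f (Suc i) \<and> (i \<in> D \<longrightarrow> f i < f (Suc i))" if "1 \<le> i" "i \<le> n" for i
        using f that unfolding weak_seqs_def by simp
      have "f i < (if n \<in> D then q else Suc q)" if "1 \<le> i" "i \<le> n" for i
        using weak_seqs_mono[OF f, of i n] step[of n] that assms q by auto
      then show "f(Suc n := undefined) \<in> weak_seqs D n (if n \<in> D then q else Suc q)"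
        using f step q unfolding weak_seqs_def by (auto simp: PiE_def Pi_def extensional_def)
    qed
    show "(\<lambda>f. f(Suc n := q)) ` ?B \<subseteq> ?A"
      using assms unfolding weak_seqs_def
      by (auto simp: PiE_def Pi_def extensional_def less_Suc_eq split: if_splits)
  qed (auto simp: weak_seqs_def PiE_def extensional_def)
qed

text \<open>Stars and bars, where each strict ascent costs one letter. The inner induction on
  \<open>q\<close> splits off the words ending in the largest letter and matches Pascal's
  rule.\<close>

lemma card_weak_seqs:
  "card (weak_seqs D n q) = (n + q - card (D \<inter> {1..<n}) - 1) choose n"
proof (induction n arbitrary: q)
  case 0
  then show ?case by (simp add: weak_seqs_def)
next
  case (Suc n)
  show ?case
  proof (cases "n = 0")
    case True
    have "weak_seqs D (Suc 0) q = {1} \<rightarrow>\<^sub>E {..<q}" by (auto simp: weak_seqs_def)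
    then show ?thesis using True by (simp add: card_PiE)
  next
    case n: False
    define d where "d = card (D \<inter> {1..<n})"
    define e where "e = card (D \<inter> {1..<Suc n})"
    have "D \<inter> {1..<Suc n} = (if n \<in> D then insert n (D \<inter> {1..<n}) else D \<inter> {1..<n})"
      using n by (auto simp: less_Suc_eq)
    then have e: "e = (if n \<in> D then Suc d else d)" by (simp add: d_def e_def)
    have "d \<le> card {1..<n}" unfolding d_def by (intro card_mono) auto
    \<comment> \<open>This gives \<open>e \<le> n\<close>, so the subtractions in the binomials are
      exact when Pascal's rule is applied.\<close>
    then have d: "d < n" using n by simp
    have IH: "card (weak_seqs D n q) = (n + q - d - 1) choose n" for q
      using Suc.IH by (simp only: d_def)
    have "card (weak_seqs D (Suc n) q) = (Suc n + q - e - 1) choose Suc n"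
    proof (induction q)
      case 0
      have "weak_seqs D (Suc n) 0 = {}" by (auto simp: weak_seqs_def PiE_def Pi_def)
      then show ?case by simp
    next
      case (Suc q)
      \<comment> \<open>By monotonicity, a word that contains the largest letter \<open>q\<close>
        also ends in it.\<close>
      have "weak_seqs D (Suc n) (Suc q) =
          weak_seqs D (Suc n) q \<union> {f \<in> weak_seqs D (Suc n) (Suc q). f (Suc n) = q}" (is "_ = _ \<union> ?L")
      proof safe
        fix f assume f: "f \<in> weak_seqs D (Suc n) (Suc q)" and "f \<notin> weak_seqs D (Suc n) q"
        then obtain i where i: "1 \<le> i" "i \<le> Suc n" "f i = q"
          unfolding weak_seqs_def PiE_def Pi_def by (auto simp: less_Suc_eq)
        have "f (Suc n) \<le> q" using f unfolding weak_seqs_def PiE_def Pi_def by auto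
        then show "f (Suc n) = q" using weak_seqs_mono[OF f i(1,2)] i(3) by simp
      qed (auto simp: weak_seqs_def PiE_def Pi_def less_Suc_eq)
      moreover have "weak_seqs D (Suc n) q \<inter> ?L = {}"
        by (auto simp: weak_seqs_def PiE_def Pi_def)
      ultimately have "card (weak_seqs D (Suc n) (Suc q)) = card (weak_seqs D (Suc n) q) + card ?L"
        by (metis (no_types, lifting) card_Un_disjoint finite_Un finite_weak_seqs)
      also have "card ?L = ((n + Suc q - e - 1) choose n)"
        using n d by (simp add: card_weak_seqs_last IH e)
      finally show ?case using Suc.IH d e by (auto simp: Suc_diff_le split: if_splits)
    qed
    then show ?thesis unfolding e_def .
  qed
qed

subsection \<open>Symmetric matrices and involutions\<close>

definition compatible_pairs :: "nat \<Rightarrow> nat \<Rightarrow> ((nat \<Rightarrow> nat) \<times> (nat \<Rightarrow> nat)) set" where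
  "compatible_pairs q n = (SIGMA \<sigma>:involutions n. weak_seqs (descents n \<sigma>) n q)"

definition contents :: "nat \<Rightarrow> (nat \<Rightarrow> nat) \<times> (nat \<Rightarrow> nat) \<Rightarrow> nat \<times> nat \<Rightarrow> nat" where
  "contents n = (\<lambda>(\<sigma>, f) p. card {a \<in> {1..n}. (f a, f (\<sigma> a)) = p})"

lemma involutionsD:
  assumes "\<sigma> \<in> involutions n"
  shows "\<sigma> (\<sigma> a) = a" "\<sigma> a \<in> {1..n} \<longleftrightarrow> a \<in> {1..n}" "\<sigma> a = \<sigma> b \<longleftrightarrow> a = b"
    "a \<notin> {1..n} \<Longrightarrow> \<sigma> a = a"
proof -
  have p: "\<sigma> permutes {1..n}" and "\<sigma> \<circ> \<sigma> = id" using assms by (auto simp: involutions_def)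
  then show inv: "\<sigma> (\<sigma> a) = a" for a by (simp add: fun_eq_iff)
  show "\<sigma> a \<in> {1..n} \<longleftrightarrow> a \<in> {1..n}" by (rule permutes_in_image[OF p])
  show "\<sigma> a = \<sigma> b \<longleftrightarrow> a = b" using inv by metis
  show "a \<notin> {1..n} \<Longrightarrow> \<sigma> a = a" using p by (simp add: permutes_def)
qed

lemma compatible_pairs_mono:
  assumes "(\<sigma>, f) \<in> compatible_pairs q n" "a \<in> {1..n}" "b \<in> {1..n}" "a \<le> b"
  shows "f a \<le> f b"
  using assms weak_seqs_mono unfolding compatible_pairs_def by auto

text \<open>Level sets of \<open>f\<close> are intervals, and \<open>f\<close> rises strictly at
  every descent of \<sigma>; hence \<sigma> has no descent inside a level set.\<close>

lemma compatible_pairs_block: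
  assumes c: "(\<sigma>, f) \<in> compatible_pairs q n" and a: "a \<in> {1..n}" and b: "b \<in> {1..n}"
    and eq: "f a = f b"
  shows "\<sigma> a < \<sigma> b \<longleftrightarrow> a < b"
proof -
  have \<sigma>: "\<sigma> \<in> involutions n" and f: "f \<in> weak_seqs (descents n \<sigma>) n q"
    using c by (auto simp: compatible_pairs_def)
  have less: "\<sigma> a < \<sigma> b" if "a < b" "1 \<le> a" "b \<le> n" "f a = f b" for a b
    using that
  proof (induction b)
    case (Suc b)
    have b: "1 \<le> b" "b < n" using Suc.prems by auto
    then have "f a \<le> f b" "f b \<le> f (Suc b)"
      using Suc.prems(1-3) compatible_pairs_mono[OF c, of a b] compatible_pairs_mono[OF c, of b "Suc b"]
      by auto
    then have eq: "f a = f b" "f b = f (Suc b)" using Suc.prems by auto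
    then have "b \<notin> descents n \<sigma>" using f b unfolding weak_seqs_def by auto
    then have "\<sigma> b < \<sigma> (Suc b)"
      using b involutionsD(3)[OF \<sigma>, of b "Suc b"] by (auto simp: descents_def)
    then show ?case using Suc eq b by (cases "a = b") auto
  qed simp
  show ?thesis
    using less[of a b] less[of b a] a b eq by (cases a b rule: linorder_cases) auto
qed

text \<open>If \<open>h a < k a\<close>, then every element with \<open>k\<close>-value at most
  \<open>h a\<close> lies strictly below \<open>a\<close>, whereas all elements up to
  \<open>a\<close> have \<open>h\<close>-value at most \<open>h a\<close>. Equal fibre sizes rule
  this out.\<close>

lemma mono_fibres_eq:
  fixes f g :: "nat \<Rightarrow> nat"
  assumes A: "finite A" and f: "mono_on A f" and g: "mono_on A g"
    and card: "\<And>x. card {a \<in> A. f a = x} = card {a \<in> A. g a = x}" and a: "a \<in> A"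
  shows "f a = g a"
proof -
  have le: "card {b \<in> A. h b \<le> v} = (\<Sum>x\<le>v. card {b \<in> A. h b = x})" for h :: "nat \<Rightarrow> nat" and v
  proof -
    have "{b \<in> A. h b \<le> v} = (\<Union>x\<le>v. {b \<in> A. h b = x})" by auto
    also have "card \<dots> = (\<Sum>x\<le>v. card {b \<in> A. h b = x})"
      using A by (intro card_UN_disjoint) auto
    finally show ?thesis .
  qed
  have False if h: "mono_on A h" and k: "mono_on A k" and less: "h a < k a"
    and card: "\<And>x. card {a \<in> A. h a = x} = card {a \<in> A. k a = x}" for h k :: "nat \<Rightarrow> nat"
  proof -
    have "card {b \<in> A. k b \<le> h a} \<le> card {b \<in> A. b < a}"
    proof (intro card_mono)
      show "{b \<in> A. k b \<le> h a} \<subseteq> {b \<in> A. b < a}"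
        using less mono_onD[OF k a] by (fastforce simp: not_less)
    qed (use A in auto)
    also have "\<dots> < card {b \<in> A. b \<le> a}"
      using A a by (intro psubset_card_mono) auto
    also have "\<dots> \<le> card {b \<in> A. h b \<le> h a}"
      using A a mono_onD[OF h _ a] by (intro card_mono) auto
    finally show False by (simp add: le card)
  qed
  from this[OF f g] this[OF g f] card show ?thesis
    by (metis linorder_neqE_nat)
qed

text \<open>Symmetry holds because \<sigma> exchanges the positions labelled \<open>p\<close> with
  those labelled \<open>prod.swap p\<close>; the entry sum is \<open>n\<close> because each position
  carries one label.\<close>

lemma contents_in_sym_matrices:
  assumes c: "(\<sigma>, f) \<in> compatible_pairs q n"
  shows "contents n (\<sigma>, f) \<in> sym_matrices q n"
proof -
  let ?R = "{..<q} \<times> {..<q}"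
  have \<sigma>: "\<sigma> \<in> involutions n" and "f \<in> weak_seqs (descents n \<sigma>) n q"
    using c by (auto simp: compatible_pairs_def)
  then have f: "f a < q" if "a \<in> {1..n}" for a using that by (auto simp: weak_seqs_def)
  have img: "(f a, f (\<sigma> a)) \<in> ?R" if "a \<in> {1..n}" for a
    using that f[of a] f[of "\<sigma> a"] involutionsD(2)[OF \<sigma>, of a] by simp
  have "contents n (\<sigma>, f) (prod.swap p) = contents n (\<sigma>, f) p" for p
  proof -
    obtain x y where p: "p = (x, y)" by (cases p)
    have "bij_betw \<sigma> {a \<in> {1..n}. (f a, f (\<sigma> a)) = prod.swap p} {a \<in> {1..n}. (f a, f (\<sigma> a)) = p}"
      by (rule bij_betw_byWitness[where f' = \<sigma>])
        (use involutionsD(1,2)[OF \<sigma>] in \<open>auto simp: p simp del: atLeastAtMost_iff\<close>)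
    then show ?thesis by (simp add: contents_def bij_betw_same_card)
  qed
  moreover have "contents n (\<sigma>, f) p = 0" if "p \<notin> ?R" for p
    using img that by (auto simp: contents_def simp del: mem_Sigma_iff atLeastAtMost_iff)
  moreover have "sum (contents n (\<sigma>, f)) ?R = n"
  proof -
    have "(\<Sum>p\<in>?R. sum (\<lambda>_. 1) {a \<in> {1..n}. (f a, f (\<sigma> a)) = p}) = (\<Sum>a\<in>{1..n}. 1 :: nat)"
      by (rule sum.group) (use img in auto)
    then show ?thesis by (simp add: contents_def)
  qed
  ultimately show ?thesis by (simp add: sym_matrices_def del: mem_Sigma_iff split_paired_All)
qed

text \<open>Row sums give the level sizes of \<open>f\<close>, which lets \<open>f\<close> be
  recovered from the matrix.\<close>

lemma sum_contents:
  assumes "(\<sigma>, f) \<in> compatible_pairs q n"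
  shows "card {a \<in> {1..n}. f a = x} = (\<Sum>y<q. contents n (\<sigma>, f) (x, y))"
proof -
  have \<sigma>: "\<sigma> \<in> involutions n" and f: "f \<in> weak_seqs (descents n \<sigma>) n q"
    using assms by (auto simp: compatible_pairs_def)
  have "f (\<sigma> a) < q" if "a \<in> {1..n}" for a
    using f involutionsD(2)[OF \<sigma>, of a] that by (auto simp: weak_seqs_def)
  then have "{a \<in> {1..n}. f a = x} = (\<Union>y<q. {a \<in> {1..n}. (f a, f (\<sigma> a)) = (x, y)})"
    by auto
  also have "card \<dots> = (\<Sum>y<q. card {a \<in> {1..n}. (f a, f (\<sigma> a)) = (x, y)})"
    by (rule card_UN_disjoint) auto
  finally show ?thesis by (simp add: contents_def)
qed

text \<open>This says that \<sigma> is the standardization of \<open>f \<circ> \<sigma>\<close>.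
  Different values are settled by monotonicity of \<open>f\<close>, ties by
  \<open>compatible_pairs_block\<close> at the positions \<open>\<sigma> a\<close> and
  \<open>\<sigma> b\<close>, where \<sigma> undoes itself.\<close>

lemma compatible_pairs_less_iff:
  assumes c: "(\<sigma>, f) \<in> compatible_pairs q n" and a: "a \<in> {1..n}" and b: "b \<in> {1..n}"
  shows "\<sigma> a < \<sigma> b \<longleftrightarrow> f (\<sigma> a) < f (\<sigma> b) \<or> f (\<sigma> a) = f (\<sigma> b) \<and> a < b"
proof -
  have \<sigma>: "\<sigma> \<in> involutions n" using c by (simp add: compatible_pairs_def)
  have in_range: "\<sigma> a \<in> {1..n}" "\<sigma> b \<in> {1..n}" using involutionsD(2)[OF \<sigma>] a b by blast+
  show ?thesis
  proof (cases "f (\<sigma> a)" "f (\<sigma> b)" rule: linorder_cases)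
    case less
    then have "\<not> \<sigma> b \<le> \<sigma> a" using compatible_pairs_mono[OF c in_range(2,1)] by auto
    with less show ?thesis by auto
  next
    case equal
    then show ?thesis
      using compatible_pairs_block[OF c in_range] involutionsD(1)[OF \<sigma>] by simp
  next
    case greater
    then show ?thesis using compatible_pairs_mono[OF c in_range] by auto
  qed
qed

text \<open>
  The row sums determine the weakly increasing \<open>f\<close>; on each level set of \<open>f\<close> the corresponding row
  determines \<open>f \<circ> \<sigma>\<close>; and \<open>\<sigma>\<close> is the standardization of \<open>f \<circ> \<sigma>\<close>.
\<close>
lemma inj_on_contents: "inj_on (contents n) (compatible_pairs q n)"
proof (rule inj_onI, clarify)
  fix \<sigma> f \<tau> g
  assume c: "(\<sigma>, f) \<in> compatible_pairs q n" and d: "(\<tau>, g) \<in> compatible_pairs q n"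
    and eq: "contents n (\<sigma>, f) = contents n (\<tau>, g)"
  have \<sigma>: "\<sigma> \<in> involutions n" and \<tau>: "\<tau> \<in> involutions n"
    and f: "f \<in> weak_seqs (descents n \<sigma>) n q" and g: "g \<in> weak_seqs (descents n \<tau>) n q"
    using c d by (auto simp: compatible_pairs_def)
  have "f a = g a" if "a \<in> {1..n}" for a
  proof (rule mono_fibres_eq[OF _ _ _ _ that])
    show "mono_on {1..n} f" "mono_on {1..n} g"
      using compatible_pairs_mono[OF c] compatible_pairs_mono[OF d] by (auto intro!: mono_onI)
  qed (simp_all only: finite_atLeastAtMost sum_contents[OF c] sum_contents[OF d] eq)
  moreover have "f \<in> {1..n} \<rightarrow>\<^sub>E {..<q}" "g \<in> {1..n} \<rightarrow>\<^sub>E {..<q}"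
    using f g by (simp_all add: weak_seqs_def)
  ultimately have fg: "f = g" by (metis PiE_ext)
  have f\<sigma>\<tau>: "f (\<sigma> a) = f (\<tau> a)" if a: "a \<in> {1..n}" for a
  proof -
    define A where "A = {b \<in> {1..n}. f b = f a}"
    have mono: "mono_on A (\<lambda>b. f (\<rho> b))" if e: "(\<rho>, f) \<in> compatible_pairs q n" for \<rho>
    proof (rule mono_onI)
      fix b b' assume b: "b \<in> A" "b' \<in> A" "b \<le> b'"
      have \<rho>: "\<rho> \<in> involutions n" using e by (simp add: compatible_pairs_def)
      have bA: "b \<in> {1..n}" "b' \<in> {1..n}" "f b' = f b" using b by (auto simp: A_def)
      then have "\<rho> b \<in> {1..n}" "\<rho> b' \<in> {1..n}"
        by (simp_all only: involutionsD(2)[OF \<rho>])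
      moreover have "\<rho> b \<le> \<rho> b'"
        using compatible_pairs_block[OF e bA(2,1,3)] b(3) by simp
      ultimately show "f (\<rho> b) \<le> f (\<rho> b')" by (rule compatible_pairs_mono[OF e])
    qed
    have fib: "card {b \<in> A. f (\<rho> b) = y} = contents n (\<rho>, f) (f a, y)" for \<rho> y
      by (auto simp: A_def contents_def intro!: arg_cong[of _ _ card])
    show ?thesis
    proof (rule mono_fibres_eq[where f = "\<lambda>b. f (\<sigma> b)" and g = "\<lambda>b. f (\<tau> b)"])
      show "finite A" "a \<in> A" using a by (auto simp: A_def)
      show "mono_on A (\<lambda>b. f (\<sigma> b))" "mono_on A (\<lambda>b. f (\<tau> b))"
        using mono[OF c] mono d fg by auto
      show "card {b \<in> A. f (\<sigma> b) = y} = card {b \<in> A. f (\<tau> b) = y}" for y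
        unfolding fib using eq fg by simp
    qed
  qed
  have less_iff: "\<sigma> a < \<sigma> b \<longleftrightarrow> \<tau> a < \<tau> b" if "a \<in> {1..n}" "b \<in> {1..n}" for a b
    using compatible_pairs_less_iff[OF c that] compatible_pairs_less_iff[OF d that]
    by (simp only: fg[symmetric] f\<sigma>\<tau>[OF that(1)] f\<sigma>\<tau>[OF that(2)])
  \<comment> \<open>A permutation value is one more than the number of smaller values, so the
    relative order of the values determines the involution.\<close>
  have rank: "\<rho> a = Suc (card {b \<in> {1..n}. \<rho> b < \<rho> a})" if a: "a \<in> {1..n}"
    and \<rho>: "\<rho> \<in> involutions n" for \<rho> a
  proof -
    have \<rho>a: "\<rho> a \<in> {1..n}" using a involutionsD(2)[OF \<rho>] by blast
    have "bij_betw \<rho> {b \<in> {1..n}. \<rho> b < \<rho> a} {1..<\<rho> a}"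
    proof (rule bij_betw_byWitness[where f' = \<rho>])
      show "\<rho> ` {b \<in> {1..n}. \<rho> b < \<rho> a} \<subseteq> {1..<\<rho> a}"
        using involutionsD(2)[OF \<rho>] by fastforce
      show "\<rho> ` {1..<\<rho> a} \<subseteq> {b \<in> {1..n}. \<rho> b < \<rho> a}"
      proof (intro image_subsetI CollectI conjI)
        fix b assume "b \<in> {1..<\<rho> a}"
        then have "b \<in> {1..n}" "b < \<rho> a" using \<rho>a by auto
        then show "\<rho> b \<in> {1..n}" "\<rho> (\<rho> b) < \<rho> a"
          by (simp_all only: involutionsD(1,2)[OF \<rho>])
      qed
    qed (simp_all add: involutionsD(1)[OF \<rho>])
    from bij_betw_same_card[OF this] show ?thesis using \<rho>a by simp
  qed
  have "\<sigma> a = \<tau> a" for a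
  proof (cases "a \<in> {1..n}")
    case True
    have "{b \<in> {1..n}. \<sigma> b < \<sigma> a} = {b \<in> {1..n}. \<tau> b < \<tau> a}"
      using less_iff True by blast
    then show ?thesis using rank[OF True \<sigma>] rank[OF True \<tau>] by simp
  next
    case False
    then show ?thesis using involutionsD(4)[OF \<sigma>] involutionsD(4)[OF \<tau>] by simp
  qed
  with fg show "\<sigma> = \<tau> \<and> f = g" by auto
qed

text \<open>
  List the units \<open>(x, y, k)\<close> of the matrix lexicographically; transposing them is the required
  involution, and the row index is the required word.
\<close>
lemma sym_matrix_in_contents:
  assumes M: "M \<in> sym_matrices q n"
  shows "M \<in> contents n ` compatible_pairs q n"
proof -
  define P where "P = {(x, y, k). k < M (x, y)}"
  define sw :: "nat \<times> nat \<times> nat \<Rightarrow> nat \<times> nat \<times> nat" where "sw = (\<lambda>(x, y, k). (y, x, k))"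
  have M_sym: "M (y, x) = M (x, y)" for x y
    using M unfolding sym_matrices_def by (metis (mono_tags, lifting) mem_Collect_eq swap_simp)
  have M_out: "M (x, y) = 0" if "\<not> (x < q \<and> y < q)" for x y
    using M that unfolding sym_matrices_def by auto
  have P_bound: "x < q" if "(x, y, k) \<in> P" for x y k
    using that M_out[of x y] by (auto simp: P_def)
  have P_Sigma: "P = (\<lambda>((x, y), k). (x, y, k)) ` (SIGMA p:{..<q} \<times> {..<q}. {..<M p})"
    using M_out by (fastforce simp: P_def image_iff)
  have "card P = (\<Sum>p\<in>{..<q} \<times> {..<q}. M p)"
    unfolding P_Sigma by (subst card_image) (auto simp: inj_on_def)
  then have card_P: "card P = n" using M by (simp add: sym_matrices_def)
  have fin_P: "finite P" unfolding P_Sigma by auto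
  obtain h where h: "bij_betw h {..<n} P" and h_mono: "strict_mono_on {..<n} h"
    using ex_bij_betw_strict_mono_card[OF fin_P] unfolding card_P by blast
  \<comment> \<open>The enumeration \<open>h\<close> starts at 0, while positions start at
    1.\<close>
  define E where "E = (\<lambda>a. h (a - 1))"
  define \<iota> where "\<iota> = the_inv_into {1..n} E"
  have "bij_betw (\<lambda>a. a - 1) {1..n} {..<n}"
    by (rule bij_betw_byWitness[where f' = Suc]) auto
  from bij_betw_trans[OF this h] have E: "bij_betw E {1..n} P"
    by (simp add: E_def comp_def)
  have E_less: "E a < E b \<longleftrightarrow> a < b" if "a \<in> {1..n}" "b \<in> {1..n}" for a b
  proof -
    have "E a < E b" if "a < b" "a \<in> {1..n}" "b \<in> {1..n}" for a b
      using that strict_mono_onD[OF h_mono, of "a - 1" "b - 1"] by (auto simp: E_def)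
    then show ?thesis using that by (metis less_asym linorder_neqE_nat order_less_irrefl)
  qed
  have E_P: "E a \<in> P" if "a \<in> {1..n}" for a using E that by (auto simp: bij_betw_def)
  have \<iota>: "\<iota> p \<in> {1..n}" "E (\<iota> p) = p" if "p \<in> P" for p
    using bij_betw_apply[OF bij_betw_the_inv_into[OF E] that] f_the_inv_into_f_bij_betw[OF E] that
    unfolding \<iota>_def by blast+
  have \<iota>E: "\<iota> (E a) = a" if "a \<in> {1..n}" for a
    using E that by (auto simp: \<iota>_def bij_betw_def the_inv_into_f_f)
  have sw: "sw (sw p) = p" "sw p \<in> P \<longleftrightarrow> p \<in> P" "fst (sw p) = fst (snd p)" for p
    by (auto simp: sw_def P_def M_sym split: prod.splits)
  define \<sigma> where "\<sigma> = (\<lambda>a. if a \<in> {1..n} then \<iota> (sw (E a)) else a)"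
  define f where "f = restrict (\<lambda>a. fst (E a)) {1..n}"
  have \<sigma>_in: "\<sigma> a \<in> {1..n}" and E\<sigma>: "E (\<sigma> a) = sw (E a)" if "a \<in> {1..n}" for a
    using \<iota>[of "sw (E a)"] E_P[OF that] sw(2) that by (auto simp: \<sigma>_def)
  have \<sigma>\<sigma>: "\<sigma> (\<sigma> a) = a" for a
  proof (cases "a \<in> {1..n}")
    case True
    then have "\<sigma> (\<sigma> a) = \<iota> (sw (E (\<sigma> a)))" using \<sigma>_in by (simp add: \<sigma>_def)
    then show ?thesis using True by (simp add: E\<sigma> sw(1) \<iota>E)
  qed (auto simp: \<sigma>_def)
  have "\<sigma> permutes {1..n}"
    unfolding permutes_def
  proof (intro conjI allI impI)
    show "\<exists>!x. \<sigma> x = y" for y by (metis \<sigma>\<sigma>)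
  qed (auto simp: \<sigma>_def)
  with \<sigma>\<sigma> have \<sigma>: "\<sigma> \<in> involutions n" by (auto simp: involutions_def)
  have f: "f \<in> weak_seqs (descents n \<sigma>) n q"
    unfolding weak_seqs_def
  proof (intro CollectI conjI allI impI)
    show "f \<in> {1..n} \<rightarrow>\<^sub>E {..<q}"
      unfolding f_def
    proof (rule restrict_PiE_iff[THEN iffD2], rule ballI)
      fix a assume "a \<in> {1..n}"
      then have "E a \<in> P" by (rule E_P)
      then show "fst (E a) \<in> {..<q}" using P_bound by (cases "E a") auto
    qed
  next
    fix i assume "1 \<le> i \<and> i < n"
    then have i: "i \<in> {1..n}" "Suc i \<in> {1..n}" by auto
    have less: "E i < E (Suc i)" using E_less[OF i] by simp
    have f: "f i = fst (E i)" "f (Suc i) = fst (E (Suc i))" using i by (simp_all add: f_def)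
    show le: "f i \<le> f (Suc i)"
      using less unfolding f by (cases "E i"; cases "E (Suc i)") auto
    assume "i \<in> descents n \<sigma>"
    then have "\<not> \<sigma> i < \<sigma> (Suc i)" by (auto simp: descents_def)
    then have "\<not> sw (E i) < sw (E (Suc i))"
      using E_less[OF \<sigma>_in[OF i(1)] \<sigma>_in[OF i(2)]]
      by (simp add: E\<sigma>[OF i(1)] E\<sigma>[OF i(2)])
    \<comment> \<open>Two units in the same row are ordered by column and then by \<open>k\<close>,
      and transposing them preserves that order; a descent therefore forces a change of row.\<close>
    then have "fst (E i) \<noteq> fst (E (Suc i))"
      using less by (cases "E i"; cases "E (Suc i)") (auto simp: sw_def)
    then show "f i < f (Suc i)" using le f by simp
  qed
  have "contents n (\<sigma>, f) (x, y) = M (x, y)" for x y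
  proof -
    have "bij_betw E {a \<in> {1..n}. (f a, f (\<sigma> a)) = (x, y)} ((\<lambda>k. (x, y, k)) ` {..<M (x, y)})"
    proof (rule bij_betw_byWitness[where f' = \<iota>])
      have key: "(f a, f (\<sigma> a)) = (fst (E a), fst (snd (E a)))" if "a \<in> {1..n}" for a
        using that \<sigma>_in[OF that] E\<sigma>[OF that] by (simp add: f_def sw(3))
      show "E ` {a \<in> {1..n}. (f a, f (\<sigma> a)) = (x, y)} \<subseteq> (\<lambda>k. (x, y, k)) ` {..<M (x, y)}"
      proof (intro image_subsetI)
        fix a assume "a \<in> {a \<in> {1..n}. (f a, f (\<sigma> a)) = (x, y)}"
        then have a: "a \<in> {1..n}" "fst (E a) = x" "fst (snd (E a)) = y" using key by auto
        then show "E a \<in> (\<lambda>k. (x, y, k)) ` {..<M (x, y)}"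
          using E_P[OF a(1)] by (cases "E a") (auto simp: P_def)
      qed
      show "\<iota> ` (\<lambda>k. (x, y, k)) ` {..<M (x, y)} \<subseteq> {a \<in> {1..n}. (f a, f (\<sigma> a)) = (x, y)}"
      proof clarify
        fix k assume "k < M (x, y)"
        then have "(x, y, k) \<in> P" by (simp add: P_def)
        from \<iota>[OF this] show "\<iota> (x, y, k) \<in> {1..n} \<and> (f (\<iota> (x, y, k)), f (\<sigma> (\<iota> (x, y, k)))) = (x, y)"
          using key by simp
      qed
    next
      show "\<forall>a\<in>{a \<in> {1..n}. (f a, f (\<sigma> a)) = (x, y)}. \<iota> (E a) = a" using \<iota>E by blast
      show "\<forall>p\<in>(\<lambda>k. (x, y, k)) ` {..<M (x, y)}. E (\<iota> p) = p"
      proof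
        fix p assume "p \<in> (\<lambda>k. (x, y, k)) ` {..<M (x, y)}"
        then have "p \<in> P" by (auto simp: P_def)
        then show "E (\<iota> p) = p" by (rule \<iota>(2))
      qed
    qed
    from bij_betw_same_card[OF this] show ?thesis
      by (simp add: contents_def card_image inj_on_def)
  qed
  then have "M = contents n (\<sigma>, f)" by auto
  then show ?thesis using \<sigma> f by (auto simp: compatible_pairs_def)
qed

lemma card_compatible_pairs: "card (compatible_pairs q n) = card (sym_matrices q n)"
proof -
  have "contents n ` compatible_pairs q n = sym_matrices q n"
    using contents_in_sym_matrices sym_matrix_in_contents by auto
  then show ?thesis using card_image[OF inj_on_contents] by metis
qed

section \<open>Expanding the matrix count by number of descents\<close>

lemma finite_involutions: "finite (involutions n)"
  unfolding involutions_def by (rule finite_Collect_conjI) (simp add: finite_permutations)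

lemma des_less: "n \<ge> 1 \<Longrightarrow> des n \<sigma> < n"
proof -
  assume "n \<ge> 1"
  have "card (descents n \<sigma>) \<le> card {1..<n}"
    by (rule card_mono) (auto simp: descents_def)
  then show ?thesis using \<open>n \<ge> 1\<close> by (simp add: des_def)
qed

text \<open>Group the compatible pairs by their involution: the number of words depends only on its
  number of descents. Taking \<open>q = Suc r\<close> absorbs the \<open>- 1\<close> of
  \<open>card_weak_seqs\<close>.\<close>

lemma card_sym_matrices_involutions:
  "card (sym_matrices (Suc r) n) = (\<Sum>k\<le>r. I n k * ((n + r - k) choose n))"
proof -
  have "descents n \<sigma> \<inter> {1..<n} = descents n \<sigma>" for \<sigma> by (auto simp: descents_def)
  then have "card (sym_matrices (Suc r) n) = (\<Sum>\<sigma>\<in>involutions n. (n + r - des n \<sigma>) choose n)"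
    unfolding card_compatible_pairs[symmetric] compatible_pairs_def
    by (subst card_SigmaI) (simp_all add: finite_involutions finite_weak_seqs card_weak_seqs des_def)
  also have "\<dots> = (\<Sum>\<sigma>\<in>{\<sigma> \<in> involutions n. des n \<sigma> \<le> r}. (n + r - des n \<sigma>) choose n)"
  proof (rule sum.mono_neutral_right)
    show "\<forall>\<sigma>\<in>involutions n - {\<sigma> \<in> involutions n. des n \<sigma> \<le> r}. (n + r - des n \<sigma>) choose n = 0"
    \<comment> \<open>For \<open>n = 0\<close> the binomial is never 0, but then there are no
      descents; for \<open>n > 0\<close> more than \<open>r\<close> descents push the upper index
      below \<open>n\<close>.\<close>
    proof (cases "n = 0")
      case True
      then have "descents n \<sigma> = {}" for \<sigma> by (auto simp: descents_def)
      then show ?thesis by (simp add: des_def)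
    next
      case False
      then show ?thesis using des_less[of n] by auto
    qed
  qed (auto simp: finite_involutions)
  also have "\<dots> = (\<Sum>k\<le>r. \<Sum>\<sigma>\<in>{\<sigma> \<in> {\<sigma> \<in> involutions n. des n \<sigma> \<le> r}. des n \<sigma> = k}. (n + r - des n \<sigma>) choose n)"
    by (rule sum.group[symmetric]) (auto simp: finite_involutions)
  also have "\<dots> = (\<Sum>k\<le>r. I n k * ((n + r - k) choose n))"
  proof (rule sum.cong)
    fix k assume "k \<in> {..r}"
    then have "{\<sigma> \<in> {\<sigma> \<in> involutions n. des n \<sigma> \<le> r}. des n \<sigma> = k} = {\<sigma> \<in> involutions n. des n \<sigma> = k}"
      by auto
    then show "(\<Sum>\<sigma>\<in>{\<sigma> \<in> {\<sigma> \<in> involutions n. des n \<sigma> \<le> r}. des n \<sigma> = k}. (n + r - des n \<sigma>) choose n)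
        = I n k * ((n + r - k) choose n)" by (simp add: I_def)
  qed simp
  finally show ?thesis .
qed

subsection \<open>The recurrence and its consequences\<close>

text \<open>This is the coefficient of \<open>t^r\<close> in \<open>A(t) / (1 - t)^(m + 1)\<close>,
  where \<open>A\<close> is the generating function of \<open>a\<close> over nonnegative indices.
  Integer indices keep later shifts and reflections free of truncation.\<close>

definition binom_sum :: "nat \<Rightarrow> (int \<Rightarrow> int) \<Rightarrow> nat \<Rightarrow> int" where
  "binom_sum m a r = (\<Sum>k\<le>r. a (int k) * int ((m + r - k) choose m))"

lemma sum_shift_atMost:
  fixes a :: "int \<Rightarrow> int"
  assumes "a (-1) = 0"
  shows "(\<Sum>k\<le>r. a (int k - 1) * g k) = (\<Sum>k<r. a (int k) * g (Suc k))"
proof (cases r)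
  case (Suc s)
  show ?thesis
    unfolding Suc by (subst sum.atMost_Suc_shift) (simp add: assms lessThan_Suc_atMost)
qed (simp add: assms)

text \<open>Numerator and denominator of the generating function are multiplied by
  \<open>1 - t\<close>; on coefficients this is Pascal's rule.\<close>

lemma binom_sum_raise:
  assumes "a (-1) = 0"
  shows "binom_sum m a r = binom_sum (Suc m) (\<lambda>k. a k - a (k - 1)) r"
proof -
  have "binom_sum (Suc m) (\<lambda>k. a k - a (k - 1)) r =
     (\<Sum>k\<le>r. a (int k) * int ((Suc m + r - k) choose Suc m))
     - (\<Sum>k\<le>r. a (int k - 1) * int ((Suc m + r - k) choose Suc m))"
    by (simp add: binom_sum_def left_diff_distrib sum_subtractf)
  also have "(\<Sum>k\<le>r. a (int k - 1) * int ((Suc m + r - k) choose Suc m))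
     = (\<Sum>k<r. a (int k) * int ((m + r - k) choose Suc m))"
    by (subst sum_shift_atMost) (auto simp: assms)
  also have "\<dots> = (\<Sum>k\<le>r. a (int k) * int ((m + r - k) choose Suc m))"
    by (simp flip: lessThan_Suc_atMost)
  also have "(\<Sum>k\<le>r. a (int k) * int ((Suc m + r - k) choose Suc m)) - \<dots>
     = binom_sum m a r"
    unfolding binom_sum_def sum_subtractf[symmetric]
    by (rule sum.cong) (auto simp: Suc_diff_le algebra_simps)
  finally show ?thesis ..
qed

lemma worpitzky:
  "(int k + int j + 1) * int ((m + j) choose m) =
   (int k + 1) * int ((Suc m + j) choose Suc m) + (int m - int k) * int ((m + j) choose Suc m)"
proof -
  have "Suc m * ((m + j) choose Suc m) = j * ((m + j) choose m)"
    using Suc_times_binomial_eq[of "m + j" m] by (simp add: algebra_simps)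
  then have "int (Suc m) * int ((m + j) choose Suc m) = int j * int ((m + j) choose m)"
    by (metis of_nat_mult)
  then show ?thesis by (simp add: algebra_simps)
qed

text \<open>Summing \<open>worpitzky\<close> with \<open>j = r - k\<close> raises the lower index by
  one. The operator on \<open>a\<close> is that of the Eulerian recurrence.\<close>

lemma binom_sum_worpitzky:
  assumes "a (-1) = 0"
  shows "(int r + 1) * binom_sum m a r =
     binom_sum (Suc m) (\<lambda>k. (k + 1) * a k + (int m + 1 - k) * a (k - 1)) r"
proof -
  let ?b = "\<lambda>k. (int m - k) * a k"
  have "binom_sum (Suc m) (\<lambda>k. (k + 1) * a k + (int m + 1 - k) * a (k - 1)) r =
     (\<Sum>k\<le>r. (int k + 1) * a (int k) * int ((Suc m + r - k) choose Suc m))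
     + (\<Sum>k\<le>r. ?b (int k - 1) * int ((Suc m + r - k) choose Suc m))"
    unfolding binom_sum_def sum.distrib[symmetric] by (rule sum.cong) (simp_all add: algebra_simps)
  also have "(\<Sum>k\<le>r. ?b (int k - 1) * int ((Suc m + r - k) choose Suc m))
     = (\<Sum>k<r. ?b (int k) * int ((m + r - k) choose Suc m))"
    by (subst sum_shift_atMost) (auto simp: assms)
  also have "\<dots> = (\<Sum>k\<le>r. ?b (int k) * int ((m + r - k) choose Suc m))"
    by (simp flip: lessThan_Suc_atMost)
  also have "(\<Sum>k\<le>r. (int k + 1) * a (int k) * int ((Suc m + r - k) choose Suc m)) + \<dots>
     = (int r + 1) * binom_sum m a r"
    unfolding binom_sum_def sum_distrib_left sum.distrib[symmetric]
  proof (rule sum.cong)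
    fix k assume "k \<in> {..r}"
    then obtain j where r: "r = k + j" using le_Suc_ex by auto
    have "m + r - k = m + j" "Suc m + r - k = Suc m + j" "int r = int k + int j"
      by (auto simp: r)
    then show "(int k + 1) * a (int k) * int ((Suc m + r - k) choose Suc m)
       + ?b (int k) * int ((m + r - k) choose Suc m)
       = (int r + 1) * (a (int k) * int ((m + r - k) choose m))"
      using arg_cong[OF worpitzky[of k j m], of "\<lambda>x. a (int k) * x"]
      by (simp only: algebra_simps)
  qed simp
  finally show ?thesis ..
qed

text \<open>The linear system is triangular with unit diagonal, since the term \<open>k = r\<close>
  has coefficient \<open>m choose m\<close>.\<close>

lemma binom_sum_inject:
  assumes "\<And>r. binom_sum m a r = binom_sum m b r"
  shows "a (int k) = b (int k)"
proof (induction k rule: less_induct)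
  case (less k)
  have split: "binom_sum m c k = (\<Sum>i<k. c (int i) * int ((m + k - i) choose m)) + c (int k)" for c
    by (simp add: binom_sum_def flip: lessThan_Suc_atMost)
  show ?case
    using assms[of k] less unfolding split by simp
qed

lemma binom_sum_add: "binom_sum m (\<lambda>k. a k + b k) r = binom_sum m a r + binom_sum m b r"
  by (simp add: binom_sum_def algebra_simps sum.distrib)

lemma binom_sum_scale: "binom_sum m (\<lambda>k. c * a k) r = c * binom_sum m a r"
  by (simp add: binom_sum_def algebra_simps sum_distrib_left)

text \<open>All sums are brought to lower index \<open>N\<close> and coefficients are compared: one
  Worpitzky step for the \<open>N - 1\<close> term, two for the factor \<open>(r + 1)^2\<close>, and
  two plain raises for the constant \<open>n - 2\<close>.\<close>

lemma binom_sum_recurrence: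
  fixes a :: "nat \<Rightarrow> int \<Rightarrow> int" and N :: nat
  defines "n \<equiv> int N"
  assumes neg: "\<And>i k. k < 0 \<Longrightarrow> a i k = 0" and N: "N \<ge> 2"
    and S: "\<And>r. n * binom_sum N (a N) r = (int r + 1) * binom_sum (N - 1) (a (N - 1)) r
              + ((int r + 1)^2 + n - 2) * binom_sum (N - 2) (a (N - 2)) r"
  shows "n * a N k = (k + 1) * a (N - 1) k + (n - k) * a (N - 1) (k - 1)
      + ((k + 1)^2 + n - 2) * a (N - 2) k + (2 * k * (n - k - 1) - n + 3) * a (N - 2) (k - 1)
      + ((n - k)^2 + n - 2) * a (N - 2) (k - 2)"
proof (cases "k < 0")
  case False
  obtain m where m: "N = Suc (Suc m)" using N by (metis add_2_eq_Suc le_Suc_ex)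
  define b where "b = a m"
  \<comment> \<open>\<open>T\<close> is the coefficient operator of
    \<open>binom_sum_worpitzky\<close>, and \<open>U\<close> that of
    \<open>binom_sum_raise\<close>.\<close>
  define T where "T = (\<lambda>m c k. (k + 1) * c k + (int m + 1 - k) * c (k - 1 :: int) :: int)"
  define U where "U = (\<lambda>c k. c k - c (k - 1 :: int) :: int)"
  have n: "n = int m + 2" by (simp add: n_def m)
  have b0: "b (-1) = 0" "T m b (-1) = 0" "U b (-1) = 0" "a (Suc m) (-1) = 0"
    by (auto simp: neg b_def T_def U_def)
  have T1: "(int r + 1) * binom_sum (Suc m) c r = binom_sum N (T (Suc m) c) r" if "c (-1) = 0" for c r
    using binom_sum_worpitzky[of c r "Suc m", OF that] by (simp add: m T_def)
  have T2: "(int r + 1)^2 * binom_sum m b r = binom_sum N (T (Suc m) (T m b)) r" for r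
    using T1[of "T m b", OF b0(2)] binom_sum_worpitzky[of b r m, OF b0(1)]
    by (simp add: T_def power2_eq_square mult.assoc)
  have U2: "binom_sum m b r = binom_sum N (U (U b)) r" for r
    using binom_sum_raise[of b m r, OF b0(1)] binom_sum_raise[of "U b" "Suc m" r, OF b0(3)]
    by (simp add: m U_def)
  let ?c = "\<lambda>k. (T (Suc m) (a (Suc m)) k + T (Suc m) (T m b) k) + int m * U (U b) k"
  have "binom_sum N (\<lambda>k. n * a N k) r = binom_sum N ?c r" for r
    unfolding binom_sum_add binom_sum_scale T1[of "a (Suc m)", OF b0(4), symmetric] T2[symmetric] U2[symmetric]
    using S[of r] by (simp add: m n b_def algebra_simps)
  from binom_sum_inject[OF this, of "nat k"] False
  have "n * a N k = ?c k" by simp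
  also have "\<dots> = (k + 1) * a (N - 1) k + (n - k) * a (N - 1) (k - 1)
      + ((k + 1)^2 + n - 2) * a (N - 2) k + (2 * k * (n - k - 1) - n + 3) * a (N - 2) (k - 1)
      + ((n - k)^2 + n - 2) * a (N - 2) (k - 2)"
    by (simp add: T_def U_def n m b_def power2_eq_square algebra_simps)
  finally show ?thesis .
qed (simp add: neg)

section \<open>Symmetry and monotonicity from the recurrence\<close>

locale involution_recurrence =
  fixes a :: "nat \<Rightarrow> int \<Rightarrow> int"
  assumes neg: "k < 0 \<Longrightarrow> a N k = 0"
    and a0: "a 0 k = (if k = 0 then 1 else 0)"
    and a1: "a 1 k = (if k = 0 then 1 else 0)"
    and rec: "N \<ge> 2 \<Longrightarrow> int N * a N k = (k + 1) * a (N - 1) k + (int N - k) * a (N - 1) (k - 1)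
      + ((k + 1)^2 + int N - 2) * a (N - 2) k + (2 * k * (int N - k - 1) - int N + 3) * a (N - 2) (k - 1)
      + ((int N - k)^2 + int N - 2) * a (N - 2) (k - 2)"
    and nonneg: "a N k \<ge> 0"
begin

lemma a2: "a 2 k = (if k = 0 \<or> k = 1 then 1 else 0)"
proof -
  \<comment> \<open>Outside these values every term on the right of the recurrence vanishes; at
    \<open>k = 2\<close> the coefficients do.\<close>
  consider "k = 0" | "k = 1" | "k = 2" | "k \<notin> {0,1,2}" by auto
  then show ?thesis
    using rec[of 2 k] a0 a1 by cases auto
qed

text \<open>These values settle the exceptional case \<open>N = 5\<close>, \<open>k = 2\<close> of
  \<open>increasing\<close>.\<close>

lemma a3: "a 3 0 = 1" "a 3 1 = 2"
  using rec[of 3 0] rec[of 3 1] a1 a2 by auto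

text \<open>The reflection exchanges the two terms at \<open>N - 1\<close> and the outer two terms
  at \<open>N - 2\<close>, coefficients included, and fixes the middle term.\<close>

lemma symmetric: "N \<ge> 1 \<Longrightarrow> a N (int N - 1 - k) = a N k"
proof (induction N arbitrary: k rule: less_induct)
  case (less N)
  \<comment> \<open>\<open>N = 2\<close> is separate because the symmetry fails for
    \<open>a 0\<close>.\<close>
  consider "N = 1" | "N = 2" | "N \<ge> 3" using less.prems by linarith
  then show ?case
  proof cases
    case 3
    let ?n = "int N" and ?b = "a (N - 1)" and ?c = "a (N - 2)"
    have N2: "N \<ge> 2" using 3 by simp
    have 1: "?b (?n - 2 - j) = ?b j" for j
      using less.IH[of "N - 1" j] 3 by (simp add: of_nat_diff)
    have 2: "?c (?n - 3 - j) = ?c j" for j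
      using less.IH[of "N - 2" j] 3 by (simp add: of_nat_diff)
    have idx: "?b (?n - 1 - k) = ?b (k - 1)" "?b (?n - 1 - k - 1) = ?b k"
      "?c (?n - 1 - k) = ?c (k - 2)" "?c (?n - 1 - k - 1) = ?c (k - 1)" "?c (?n - 1 - k - 2) = ?c k"
      using 1[of "k - 1"] 1[of k] 2[of "k - 2"] 2[of "k - 1"] 2[of k] by (simp_all add: algebra_simps)
    have "?n * a N (?n - 1 - k) = ?n * a N k"
      unfolding rec[OF N2, of k] rec[OF N2, of "?n - 1 - k"] idx
      by (simp add: power2_eq_square algebra_simps)
    then show ?thesis using 3 by simp
  qed (auto simp: a1[simplified] a2)
qed

text \<open>The recurrence is differenced in \<open>k\<close> and the induction hypothesis applied
  to the differences on the right. Differences just past the middle escape the hypothesis and are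
  evaluated by \<open>symmetric\<close>.\<close>

lemma increasing:
  assumes "N \<ge> 1" "2 * k \<le> int N - 1"
  shows "a N (k - 1) \<le> a N k"
  using assms
proof (induction N arbitrary: k rule: less_induct)
  case (less N)
  consider "k \<le> 0" | "N \<le> 2" "k > 0" | "N \<ge> 3" "k \<ge> 1" by linarith
  then show ?case
  proof cases
    case 1
    then show ?thesis using neg[of "k - 1" N] nonneg by simp
  next
    case 2
    then show ?thesis using less.prems by auto
  next
    case 3
    let ?n = "int N" and ?b = "a (N - 1)" and ?c = "a (N - 2)"
    \<comment> \<open>Summation by parts: these are the partial sums of the coefficients of
      \<open>?c k\<close>, \<open>?c (k - 1)\<close>, \<open>?c (k - 2)\<close> in the differenced
      recurrence.\<close>
    define \<alpha> \<beta> \<gamma> where "\<alpha> = (k + 1)^2 + ?n - 2" and "\<beta> = 2 * k * (?n - k) - ?n + 4"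
      and "\<gamma> = (?n - k + 1)^2 + ?n - 2"
    define x y z where "x = ?c k - ?c (k - 1)" and "y = ?c (k - 1) - ?c (k - 2)"
      and "z = ?c (k - 2) - ?c (k - 3)"
    have "k - 1 - 1 = k - 2" "k - 1 - 2 = k - 3" by auto
    then have eq: "?n * (a N k - a N (k - 1)) =
        (k + 1) * (?b k - ?b (k - 1)) + (?n - k + 1) * (?b (k - 1) - ?b (k - 2))
        + (\<alpha> * x + \<beta> * y + \<gamma> * z)"
      using rec[of N k] rec[of N "k - 1"] 3
      by (simp add: \<alpha>_def \<beta>_def \<gamma>_def x_def y_def z_def power2_eq_square algebra_simps)
    have inc_b: "?b (j - 1) \<le> ?b j" if "2 * j \<le> ?n - 2" for j
      using less.IH[of "N - 1" j] that 3 by (simp add: of_nat_diff)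
    have inc_c: "?c (j - 1) \<le> ?c j" if "2 * j \<le> ?n - 3" for j
      using less.IH[of "N - 2" j] that 3 by (simp add: of_nat_diff)
    have sym_b: "?b (?n - 2 - j) = ?b j" for j
      using symmetric[of "N - 1" j] 3 by (simp add: of_nat_diff)
    have sym_c: "?c (?n - 3 - j) = ?c j" for j
      using symmetric[of "N - 2" j] 3 by (simp add: of_nat_diff)
    \<comment> \<open>In the one case outside the hypothesis, \<open>2 * k = ?n - 1\<close>, the
      indices \<open>k\<close> and \<open>k - 1\<close> are mirror images and the values
      agree.\<close>
    have b1: "?b (k - 1) \<le> ?b k"
    proof (cases "2 * k \<le> ?n - 2")
      case False
      then have "?n - 2 - k = k - 1" using less.prems by linarith
      then show ?thesis using sym_b[of k] by simp
    qed (rule inc_b)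
    have b2: "?b (k - 2) \<le> ?b (k - 1)"
      using inc_b[of "k - 1"] less.prems by simp
    have z: "z \<ge> 0" and y: "y \<ge> 0"
      using inc_c[of "k - 2"] inc_c[of "k - 1"] less.prems by (auto simp: y_def z_def)
    have \<alpha>: "\<alpha> \<ge> 0" and \<gamma>: "\<gamma> \<ge> 0"
      using 3 zero_le_power2[of "k + 1"] zero_le_power2[of "?n - k + 1"]
      unfolding \<alpha>_def \<gamma>_def by linarith+
    have \<beta>: "\<beta> \<ge> 0"
    proof -
      have "(k - 1) * (?n - k - 1) \<ge> 0" using 3 less.prems by (intro mult_nonneg_nonneg) auto
      then have "k * (?n - k) \<ge> ?n - 1" by (simp add: algebra_simps)
      then show ?thesis using 3 by (simp add: \<beta>_def)
    qed
    have "\<alpha> * x + \<beta> * y + \<gamma> * z \<ge> 0"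
    proof -
      \<comment> \<open>Only \<open>x\<close> can leave the range of the hypothesis; reflection then
        gives \<open>x = 0\<close> or \<open>x = - y\<close>.\<close>
      consider "2 * k \<le> ?n - 3" | "2 * k = ?n - 2" | "2 * k = ?n - 1" using less.prems by linarith
      then show ?thesis
      proof cases
        case 1
        then have "x \<ge> 0" using inc_c[of k] by (simp add: x_def)
        then show ?thesis using \<alpha> \<beta> \<gamma> y z by simp
      next
        case 2
        then have "?n - 3 - k = k - 1" by linarith
        then have "x = 0" using sym_c[of k] by (simp add: x_def)
        then show ?thesis using \<beta> \<gamma> y z by simp
      next
        case c3: 3
        then have n: "?n = 2 * k + 1" by linarith
        then have "?n - 3 - k = k - 2" by linarith
        then have x: "x = - y" using sym_c[of k] by (simp add: x_def y_def)
        have ba: "\<beta> - \<alpha> = (k - 1) * (k - 3)"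
          unfolding \<alpha>_def \<beta>_def n by (simp add: power2_eq_square algebra_simps)
        show ?thesis
        proof (cases "k = 2") \<comment> \<open>the only \<open>k \<ge> 1\<close> with \<open>\<beta> < \<alpha>\<close>\<close>
          case True
          \<comment> \<open>Here \<open>y = z = 1\<close>, \<beta> - \<alpha> is -1 and \<gamma> is
            19, so the term in \<open>z\<close> compensates.\<close>
          then have "N = 5" using n by linarith
          then show ?thesis using True
            by (simp add: \<alpha>_def \<beta>_def \<gamma>_def x y_def z_def a3 neg)
        next
          case False
          then have "\<beta> - \<alpha> \<ge> 0"
            unfolding ba using 3 by (cases "k = 1") auto
          then have "(\<beta> - \<alpha>) * y + \<gamma> * z \<ge> 0" using y z \<gamma> by simp
          then show ?thesis by (simp add: x algebra_simps)
        qed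
      qed
    qed
    moreover have "(k + 1) * (?b k - ?b (k - 1)) \<ge> 0" "(?n - k + 1) * (?b (k - 1) - ?b (k - 2)) \<ge> 0"
      using b1 b2 3 less.prems by simp_all
    ultimately have "?n * (a N k - a N (k - 1)) \<ge> 0" using eq by linarith
    then show ?thesis using 3 by (simp add: zero_le_mult_iff)
  qed
qed

end

text \<open>This is \<open>card_sym_matrices_rec\<close> with \<open>q = r + 1\<close>, read through
  the binomial expansion of the matrix counts.\<close>

lemma I_recurrence_count:
  assumes "N \<ge> 2"
  shows "int N * binom_sum N (\<lambda>k. if k < 0 then 0 else int (I N (nat k))) r =
      (int r + 1) * binom_sum (N - 1) (\<lambda>k. if k < 0 then 0 else int (I (N - 1) (nat k))) r
      + ((int r + 1)^2 + int N - 2) * binom_sum (N - 2) (\<lambda>k. if k < 0 then 0 else int (I (N - 2) (nat k))) r"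
proof -
  have S: "binom_sum m (\<lambda>k. if k < 0 then 0 else int (I m (nat k))) r = int (card (sym_matrices (Suc r) m))" for m
    by (simp add: binom_sum_def card_sym_matrices_involutions)
  obtain n where N: "N = n + 2" using assms by (metis le_add_diff_inverse2)
  show ?thesis
    using arg_cong[OF card_sym_matrices_rec[of n "Suc r"], of int]
    unfolding S by (simp add: N algebra_simps power2_eq_square)
qed

lemma I_small: "n \<le> 1 \<Longrightarrow> I n k = (if k = 0 then 1 else 0)"
proof -
  assume n: "n \<le> 1"
  have "p permutes {1..n} \<longleftrightarrow> p = id" for p
    using n by (cases "n = 0") (auto simp: le_Suc_eq)
  moreover have "descents n p = {}" for p
    using n by (auto simp: descents_def)
  ultimately have "{p \<in> involutions n. des n p = k} = (if k = 0 then {id} else {})"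
    by (auto simp: involutions_def des_def)
  then show ?thesis by (simp add: I_def)
qed

text \<open>\<open>nat\<close> sends negative integers to 0, so the value 0 at negative indices has
  to be imposed explicitly.\<close>

interpretation I: involution_recurrence "\<lambda>n k. if k < 0 then 0 else int (I n (nat k))"
proof
  fix N k
  assume "N \<ge> (2::nat)"
  then show "int N * (if k < 0 then 0 else int (I N (nat k))) =
      (k + 1) * (if k < 0 then 0 else int (I (N - 1) (nat k)))
      + (int N - k) * (if k - 1 < 0 then 0 else int (I (N - 1) (nat (k - 1))))
      + ((k + 1)^2 + int N - 2) * (if k < 0 then 0 else int (I (N - 2) (nat k)))
      + (2 * k * (int N - k - 1) - int N + 3) * (if k - 1 < 0 then 0 else int (I (N - 2) (nat (k - 1))))
      + ((int N - k)^2 + int N - 2) * (if k - 2 < 0 then 0 else int (I (N - 2) (nat (k - 2))))"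
    by (intro binom_sum_recurrence I_recurrence_count) auto
qed (auto simp: I_small)

lemma I_symmetric:
  assumes "k < n"
  shows "I n (n - 1 - k) = I n k"
proof -
  have "int n - 1 - int k = int (n - 1 - k)" using assms by linarith
  then show ?thesis using I.symmetric[of n "int k"] assms by (simp del: of_nat_diff)
qed

lemma I_increasing:
  assumes "2 * Suc k < n"
  shows "I n k \<le> I n (Suc k)"
proof -
  have "nat (1 + int k) = Suc k" by linarith
  then show ?thesis using I.increasing[of n "int (Suc k)"] assms by simp
qed

theorem theorem3p3:
  fixes n :: nat
  assumes "n \<ge> 1"
  shows "\<exists>j. j \<le> n - 1 \<and>
           (\<forall>i. i < j \<longrightarrow> I n i \<le> I n (Suc i)) \<and>
           (\<forall>i. j \<le> i \<and> i < n - 1 \<longrightarrow> I n i \<ge> I n (Suc i))"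
proof (intro exI[of _ "(n - 1) div 2"] conjI allI impI)
  fix i assume "i < (n - 1) div 2"
  then show "I n i \<le> I n (Suc i)" by (intro I_increasing) presburger
next
  fix i assume i: "(n - 1) div 2 \<le> i \<and> i < n - 1"
  \<comment> \<open>Reflection sends the pair \<open>i\<close>, \<open>Suc i\<close> to
    \<open>Suc k\<close>, \<open>k\<close>, which lies in the increasing half or, when
    \<open>k = i\<close>, is the same pair reversed.\<close>
  define k where "k = n - 1 - Suc i"
  have n: "n = k + i + 2" using i by (auto simp: k_def)
  have eq: "I n i = I n (Suc k)" "I n (Suc i) = I n k"
    using I_symmetric[of i n] I_symmetric[of "Suc i" n] by (simp_all add: n)
  have "k \<le> i"
    using i div_less_iff_less_mult[of 2 "n - 1" "Suc i"] n by linarith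
  then consider "k = i" | "k < i" by linarith
  then show "I n i \<ge> I n (Suc i)"
  proof cases
    case 2
    then have "2 * Suc k < n" by (simp add: n)
    then show ?thesis unfolding eq by (rule I_increasing)
  qed (use eq in simp)
qed simp

end
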